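(* Let $\mathcal{H}$ be a real Hilbert space and $q\in\mathcal{H}$. Let $A\colon\mathcal{H}\rightrightarrows\mathcal{H}$ be maximally $\alpha_A$-monotone with $\alpha_A\in\mathbb{R}$, and let $\gamma,\theta,\sigma_A,\sigma_B>0$. Suppose one of the following holds: (i) $B\colon\mathcal{H}\to\mathcal{H}$ is $\alpha_B$-monotone (with $\alpha_B\in\mathbb{R}$) and $\kappa$-Lipschitz continuous ($\kappa>0$), and $0<\gamma<\frac{2(\theta\alpha_B+\sigma_B)}{(\theta\kappa+\sigma_B)^2}$. (ii) $B\colon\mathcal{H}\to\mathcal{H}$ is $\beta$-cocoercive for some $\beta>0$ and $0<\gamma<\frac{2\beta}{\theta+\beta\sigma_B}$. In this case, set $\alpha_B:=0$. Suppose that $\theta\alpha_A+\sigma_A>0$ and $\theta\alpha_B+\sigma_B>0$. For any initial point $x_0\in\mathcal{H}$, consider the sequence $(x_k)$ given by $$x_{k+1}=J_{\frac{\gamma\theta}{1+\gamma\sigma_A}A}\left(\frac{1}{1+\gamma\sigma_A}\bigl((1-\gamma\sigma_B)x_k-\gamma\theta B(x_k)+\gamma(\sigma_A+\sigma_B)q\bigr)\right),\quad\forall k\in\mathbb{N}.$$ Then $(x_k)$ converges linearly to $J_{\frac{\theta}{\sigma_A+\sigma_B}(A+B)}(q)$.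
   Context: For $\alpha\in\mathbb{R}$, a set-valued operator $A\colon\mathcal{H}\rightrightarrows\mathcal{H}$ is $\alpha$-monotone if $\langle x-y,u-v\rangle\ge\alpha\|x-y\|^2$ for all $(x,u),(y,v)$ in its graph, and maximally $\alpha$-monotone if moreover no $\alpha$-monotone operator has a graph properly containing that of $A$. The resolvent of $A$ with parameter $\gamma>0$ is $J_{\gamma A}:=(\mathrm{Id}+\gamma A)^{-1}$ (a singleton $\{u\}$ is identified with $u$). $B\colon\mathcal{H}\to\mathcal{H}$ is $\beta$-cocoercive if $\langle x-y,B(x)-B(y)\rangle\ge\beta\|B(x)-B(y)\|^2$ for all $x,y\in\mathcal{H}$. A sequence $(x_k)$ converges linearly to $x$ if $\limsup_{k\to\infty}\frac{\|x_{k+1}-x\|}{\|x_k-x\|}<1$. *)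

theory Defs
  imports "HOL-Analysis.Analysis"
begin

definition op_graph :: "('a \<Rightarrow> 'b set) \<Rightarrow> ('a \<times> 'b) set" where
  "op_graph A = {(x, u). u \<in> A x}"

definition alpha_monotone :: "real \<Rightarrow> ('a::real_inner \<Rightarrow> 'a set) \<Rightarrow> bool" where
  "alpha_monotone \<alpha> A \<longleftrightarrow>
     (\<forall>(x, u) \<in> op_graph A. \<forall>(y, v) \<in> op_graph A. (x - y) \<bullet> (u - v) \<ge> \<alpha> * (norm (x - y))\<^sup>2)"

definition maximally_alpha_monotone :: "real \<Rightarrow> ('a::real_inner \<Rightarrow> 'a set) \<Rightarrow> bool" where
  "maximally_alpha_monotone \<alpha> A \<longleftrightarrow>
     alpha_monotone \<alpha> A \<and> \<not> (\<exists>A'. alpha_monotone \<alpha> A' \<and> op_graph A \<subset> op_graph A')"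

definition cocoercive :: "real \<Rightarrow> ('a::real_inner \<Rightarrow> 'a) \<Rightarrow> bool" where
  "cocoercive \<beta> B \<longleftrightarrow> (\<forall>x y. (x - y) \<bullet> (B x - B y) \<ge> \<beta> * (norm (B x - B y))\<^sup>2)"

definition single_valued_op :: "('a \<Rightarrow> 'b) \<Rightarrow> 'a \<Rightarrow> 'b set" where
  "single_valued_op B = (\<lambda>x. {B x})"

definition op_plus :: "('a \<Rightarrow> 'b::plus set) \<Rightarrow> ('a \<Rightarrow> 'b set) \<Rightarrow> 'a \<Rightarrow> 'b set" where
  "op_plus A B = (\<lambda>x. {u + v | u v. u \<in> A x \<and> v \<in> B x})"

definition op_scale :: "real \<Rightarrow> ('a \<Rightarrow> 'b::real_vector set) \<Rightarrow> 'a \<Rightarrow> 'b set" where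
  "op_scale c A = (\<lambda>x. {c *\<^sub>R u | u. u \<in> A x})"

definition op_inverse :: "('a \<Rightarrow> 'b set) \<Rightarrow> 'b \<Rightarrow> 'a set" where
  "op_inverse A = (\<lambda>u. {x. u \<in> A x})"

definition resolvent :: "real \<Rightarrow> ('a::real_vector \<Rightarrow> 'a set) \<Rightarrow> 'a \<Rightarrow> 'a set" where
  "resolvent \<gamma> A = op_inverse (op_plus (single_valued_op id) (op_scale \<gamma> A))"

text \<open>
  A sequence generated by a set-valued map \<open>T\<close>: the recursion \<open>x (Suc k) = T (x k)\<close> is read with
  the identification of a singleton with its element, so every \<open>T (x k)\<close> has to be a singleton.
\<close>

definition generated_sequence :: "('a \<Rightarrow> 'a set) \<Rightarrow> 'a \<Rightarrow> (nat \<Rightarrow> 'a) \<Rightarrow> bool" where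
  "generated_sequence T x0 x \<longleftrightarrow> x 0 = x0 \<and> (\<forall>k. T (x k) = {x (Suc k)})"

text \<open>
  The quotient is taken in \<^typ>\<open>ereal\<close>, where \<open>0 / 0 = 0\<close> but \<open>a / 0 = \<infinity>\<close> for \<open>a > 0\<close>.
  Hence a sequence that reaches its limit and stays there converges linearly, whereas one that
  keeps leaving its limit does not (with the total real division it would).
\<close>

definition converges_linearly :: "(nat \<Rightarrow> 'a::real_normed_vector) \<Rightarrow> 'a \<Rightarrow> bool" where
  "converges_linearly x l \<longleftrightarrow>
     limsup (\<lambda>k. ereal (norm (x (Suc k) - l)) / ereal (norm (x k - l))) < 1"

end

theory Submission imports Defs
begin

text \<open>
  The iteration map is a contraction: the forward step is Lipschitz with constant less than 1, the
  scaling by \<open>1 / (1 + \<gamma> \<sigma>\<^sub>A)\<close> followed by the resolvent of \<open>A\<close> with constant at most 1, and the fixed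
  points are exactly the elements of the resolvent of \<open>A + B\<close> at \<open>q\<close>. That the resolvent of \<open>A\<close> has full domain is Minty's theorem,
  proved here by minimising the sum of the Fitzpatrick function of the operator and half the squared
  norm of \<open>H \<times> H\<close>: if \<open>(a, b)\<close> is the minimiser, the first-order condition places \<open>(-b, -a)\<close> in the
  graph and forces \<open>a + b = 0\<close>.
\<close>

section \<open>Minimisation over a closed convex epigraph\<close>

lemma norm_midpoint_sq:
  fixes x y :: "'a::real_inner"
  shows "(norm ((1/2) *\<^sub>R x + (1/2) *\<^sub>R y))\<^sup>2
    = (norm x)\<^sup>2 / 2 + (norm y)\<^sup>2 / 2 - (norm (x - y))\<^sup>2 / 4"
  by (simp add: power2_norm_eq_inner inner_simps inner_commute field_simps)

text \<open>
  Here \<open>E\<close> plays the role of the epigraph of a convex lower semicontinuous function \<open>f\<close>, so that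
  \<open>f\<close> need not be given an infinite value, and the point found minimises \<open>f + norm\<^sup>2 / 2\<close>.
\<close>

lemma closed_convex_epigraph_proximal_point:
  fixes E :: "('b::{real_inner, complete_space} \<times> real) set"
  assumes "closed E" and "convex E" and "E \<noteq> {}"
    and lower: "\<And>z t. (z, t) \<in> E \<Longrightarrow> m0 \<le> t + (norm z)\<^sup>2 / 2"
  obtains z t where "(z, t) \<in> E" and "\<And>w s. (w, s) \<in> E \<Longrightarrow> 0 \<le> s - t + z \<bullet> (w - z)"
proof -
  define h :: "'b \<times> real \<Rightarrow> real" where "h p = snd p + (norm (fst p))\<^sup>2 / 2" for p
  define m where "m = Inf (h ` E)"
  have bdd: "bdd_below (h ` E)"
    using lower by (intro bdd_belowI2[of _ m0]) (auto simp: h_def)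
  have m_le: "m \<le> h p" if "p \<in> E" for p
    unfolding m_def using bdd that by (intro cInf_lower) auto
  have "\<exists>p\<in>E. h p < m + inverse (real (Suc n))" for n
    using cInf_lessD[of "h ` E" "m + inverse (real (Suc n))"] \<open>E \<noteq> {}\<close> by (auto simp: m_def)
  then obtain p where pE: "p n \<in> E" and p_lt: "h (p n) < m + inverse (real (Suc n))" for n
    by metis
  \<comment> \<open>The midpoint of \<open>p i\<close> and \<open>p j\<close> lies in
    \<open>E\<close>, so \<open>h\<close> is at least \<open>m\<close> there; strong convexity of
    the squared norm then bounds the distance by the two excesses over \<open>m\<close>.\<close>
  have gap: "(norm (fst (p i) - fst (p j)))\<^sup>2
      \<le> 4 * (inverse (real (Suc i)) + inverse (real (Suc j)))" for i j
  proof -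
    have "(1/2) *\<^sub>R p i + (1/2) *\<^sub>R p j \<in> E"
      using pE \<open>convex E\<close> by (intro convexD) auto
    from m_le[OF this] have "m \<le> h (p i) / 2 + h (p j) / 2 - (norm (fst (p i) - fst (p j)))\<^sup>2 / 8"
      by (simp add: h_def norm_midpoint_sq field_simps)
    with p_lt[of i] p_lt[of j] show ?thesis by argo
  qed
  have "Cauchy (\<lambda>n. fst (p n))"
  proof (rule metric_CauchyI)
    fix e :: real assume "e > 0"
    obtain N where N: "inverse (real (Suc N)) < e\<^sup>2 / 8"
      using reals_Archimedean[of "e\<^sup>2 / 8"] \<open>e > 0\<close> by auto
    have small: "inverse (real (Suc n)) < e\<^sup>2 / 8" if "n \<ge> N" for n
    proof -
      have "inverse (real (Suc n)) \<le> inverse (real (Suc N))"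
        using that by (intro le_imp_inverse_le) auto
      with N show ?thesis by linarith
    qed
    have "dist (fst (p i)) (fst (p j)) < e" if "i \<ge> N" "j \<ge> N" for i j
    proof -
      have "(norm (fst (p i) - fst (p j)))\<^sup>2 < e\<^sup>2"
        using gap[of i j] small[OF that(1)] small[OF that(2)] by argo
      then show ?thesis using \<open>e > 0\<close> by (simp add: dist_norm power2_less_imp_less)
    qed
    then show "\<exists>N. \<forall>i\<ge>N. \<forall>j\<ge>N. dist (fst (p i)) (fst (p j)) < e" by blast
  qed
  then obtain z where z: "(\<lambda>n. fst (p n)) \<longlonglongrightarrow> z"
    using Cauchy_convergent_iff convergent_def by blast
  have "(\<lambda>n. h (p n)) \<longlonglongrightarrow> m"
  proof (rule tendsto_sandwich[where f = "\<lambda>_. m"])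
    show "(\<lambda>n. m + inverse (real (Suc n))) \<longlonglongrightarrow> m"
      using tendsto_add[OF tendsto_const LIMSEQ_inverse_real_of_nat, of m] by simp
    show "\<forall>\<^sub>F n in sequentially. h (p n) \<le> m + inverse (real (Suc n))"
      by (intro always_eventually allI less_imp_le p_lt)
  qed (auto intro!: always_eventually m_le pE)
  \<comment> \<open>The heights \<open>snd (p n)\<close> converge as well, being
    \<open>h (p n)\<close> minus half the squared norm, so closedness of \<open>E\<close> applies to
    the pairs.\<close>
  then have "(\<lambda>n. h (p n) - (norm (fst (p n)))\<^sup>2 / 2) \<longlonglongrightarrow> m - (norm z)\<^sup>2 / 2"
    using z by (intro tendsto_intros) simp_all
  then have "(\<lambda>n. (fst (p n), snd (p n))) \<longlonglongrightarrow> (z, m - (norm z)\<^sup>2 / 2)"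
    using z by (intro tendsto_Pair) (simp_all add: h_def)
  then have lim: "p \<longlonglongrightarrow> (z, m - (norm z)\<^sup>2 / 2)" by simp
  have zE: "(z, m - (norm z)\<^sup>2 / 2) \<in> E"
    by (rule closed_sequentially[OF \<open>closed E\<close> pE lim])
  show thesis
  proof (rule that[OF zE])
    fix w s assume wE: "(w, s) \<in> E"
    define t where "t = m - (norm z)\<^sup>2 / 2"
    define c where "c = s - t + z \<bullet> (w - z)"
    define d where "d = (norm (w - z))\<^sup>2 / 2"
    \<comment> \<open>At the fraction \<open>l\<close> of the segment from \<open>(z, t)\<close> to
      \<open>(w, s)\<close>, the function \<open>h\<close> equals
      \<open>m + l * (c + l * d)\<close>. Dividing minimality by \<open>l\<close> and letting
      \<open>l\<close> tend to 0 from the right leaves \<open>0 \<le> c\<close>.\<close>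
    have first_order: "0 \<le> c + l * d" if "0 < l" "l \<le> 1" for l
    proof -
      have "(1 - l) *\<^sub>R (z, t) + l *\<^sub>R (w, s) \<in> E"
        using zE wE that \<open>convex E\<close> unfolding t_def by (intro convexD) auto
      from m_le[OF this]
      have "m \<le> (1 - l) * t + l * s + (norm (z + l *\<^sub>R (w - z)))\<^sup>2 / 2"
        by (simp add: h_def algebra_simps)
      also have "\<dots> = m + l * (c + l * d)"
        unfolding c_def d_def t_def
        by (simp add: power2_norm_eq_inner inner_simps inner_commute) (simp add: field_simps)
      finally show ?thesis using that by (simp add: zero_le_mult_iff)
    qed
    have "((\<lambda>l. c + l * d) \<longlongrightarrow> c + 0 * d) (at_right 0)"
      by (intro tendsto_intros)
    moreover have "\<forall>\<^sub>F l in at_right 0. 0 \<le> c + l * d"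
      unfolding eventually_at_right_field by (rule exI[of _ 1]) (auto intro: first_order)
    ultimately have "0 \<le> c + 0 * d"
      by (intro tendsto_lowerbound) auto
    then show "0 \<le> s - (m - (norm z)\<^sup>2 / 2) + z \<bullet> (w - z)" by (simp add: c_def t_def)
  qed
qed

section \<open>Minty's theorem via the Fitzpatrick function\<close>

text \<open>The hypothesis packs maximal monotonicity into one equivalence: left to right is
  monotonicity, right to left is maximality. The conclusion puts only 0 into the range of
  \<open>Id + G\<close>; other right-hand sides are reached by shifting the graph.\<close>

lemma minty:
  fixes G :: "('a::{real_inner, complete_space} \<times> 'a) set"
  assumes maximal: "\<And>x u. (x, u) \<in> G \<longleftrightarrow> (\<forall>(y, v)\<in>G. 0 \<le> (x - y) \<bullet> (u - v))"
  obtains x where "(x, - x) \<in> G"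
proof -
  \<comment> \<open>\<open>E\<close> is the epigraph of the Fitzpatrick function of \<open>G\<close>.\<close>
  define E where "E = (\<Inter>(y, v)\<in>G. {((a, b), t). a \<bullet> v + y \<bullet> b - y \<bullet> v \<le> t})"
  have E_iff: "((a, b), t) \<in> E \<longleftrightarrow> (\<forall>(y, v)\<in>G. a \<bullet> v + y \<bullet> b - y \<bullet> v \<le> t)" for a b t
    by (auto simp: E_def)
  have closed: "closed E"
    unfolding E_def case_prod_beta
    by (intro closed_INT ballI closed_Collect_le continuous_intros)
  have convex: "convex E"
    unfolding E_def case_prod_beta
  proof (intro convex_INT ballI)
    fix g :: "'a \<times> 'a"
    show "convex {p :: ('a \<times> 'a) \<times> real.
        fst (fst p) \<bullet> snd g + fst g \<bullet> snd (fst p) - fst g \<bullet> snd g \<le> snd p}"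
    proof (rule convexI, clarsimp)
      fix a b t a' b' t' and l m :: real
      assume "a \<bullet> snd g + fst g \<bullet> b - fst g \<bullet> snd g \<le> t"
        and "a' \<bullet> snd g + fst g \<bullet> b' - fst g \<bullet> snd g \<le> t'"
        and lm: "0 \<le> l" "0 \<le> m" "l + m = 1"
      then have "l * (a \<bullet> snd g + fst g \<bullet> b - fst g \<bullet> snd g)
          + m * (a' \<bullet> snd g + fst g \<bullet> b' - fst g \<bullet> snd g) \<le> l * t + m * t'"
        by (intro add_mono mult_left_mono) auto
      moreover have "fst g \<bullet> snd g = l * (fst g \<bullet> snd g) + m * (fst g \<bullet> snd g)"
        using lm by (metis distrib_right mult_1)
      ultimately show "(l *\<^sub>R a + m *\<^sub>R a') \<bullet> snd g + fst g \<bullet> (l *\<^sub>R b + m *\<^sub>R b') - fst g \<bullet> snd g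
          \<le> l * t + m * t'"
        by (simp add: inner_simps algebra_simps)
    qed
  qed
  \<comment> \<open>By monotonicity the Fitzpatrick function is at most the inner product on the
    graph.\<close>
  have graph_E: "((y, v), y \<bullet> v) \<in> E" if "(y, v) \<in> G" for y v
    using that maximal[of y v] by (fastforce simp: E_iff inner_simps inner_commute)
  \<comment> \<open>If \<open>t < a \<bullet> b\<close>, then \<open>(a, b)\<close> is monotonically
    related to all of \<open>G\<close>, hence lies in \<open>G\<close>; testing membership in
    \<open>E\<close> against \<open>(a, b)\<close> itself gives
    \<open>a \<bullet> b \<le> t\<close>.\<close>
  have fitzpatrick_ge: "a \<bullet> b \<le> t" if "((a, b), t) \<in> E" for a b t
  proof (rule ccontr)
    assume neg: "\<not> a \<bullet> b \<le> t"
    have "0 \<le> (a - y) \<bullet> (b - v)" if "(y, v) \<in> G" for y v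
      using \<open>((a, b), t) \<in> E\<close> that neg by (fastforce simp: E_iff inner_simps inner_commute)
    then have "(a, b) \<in> G" using maximal by auto
    then show False using \<open>((a, b), t) \<in> E\<close> neg by (fastforce simp: E_iff)
  qed
  have sq: "(norm (a + b))\<^sup>2 = (norm (a, b))\<^sup>2 + 2 * (a \<bullet> b)" for a b :: 'a
    by (simp add: norm_Pair power2_norm_eq_inner inner_simps inner_commute)
  \<comment> \<open>For empty \<open>G\<close> the right-hand side of \<open>maximal\<close> would
    hold vacuously for every point.\<close>
  have "G \<noteq> {}" using maximal by fastforce
  then have "E \<noteq> {}" using graph_E by fastforce
  have lower: "0 \<le> t + (norm z)\<^sup>2 / 2" if "(z, t) \<in> E" for z t
  proof -
    have "fst z \<bullet> snd z \<le> t" using that fitzpatrick_ge[of "fst z" "snd z" t] by simp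
    moreover have "0 \<le> (norm z)\<^sup>2 + 2 * (fst z \<bullet> snd z)"
      using sq[of "fst z" "snd z"] zero_le_power2[of "norm (fst z + snd z)"] by simp
    ultimately show ?thesis by simp
  qed
  obtain z t where zE: "(z, t) \<in> E"
    and opt: "\<And>w s. (w, s) \<in> E \<Longrightarrow> 0 \<le> s - t + z \<bullet> (w - z)"
    using closed_convex_epigraph_proximal_point[OF closed convex \<open>E \<noteq> {}\<close> lower] by metis
  obtain a b where z: "z = (a, b)" by fastforce
  \<comment> \<open>The first-order condition is tested at the graph point
    \<open>((y, v), y \<bullet> v)\<close> of \<open>E\<close>, and \<open>t\<close> is bounded
    below by \<open>a \<bullet> b\<close>.\<close>
  have key: "(norm (a + b))\<^sup>2 \<le> (- b - y) \<bullet> (- a - v)" if "(y, v) \<in> G" for y v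
    using opt[OF graph_E[OF that]] fitzpatrick_ge[OF zE[unfolded z]]
    by (simp add: z power2_norm_eq_inner inner_simps inner_commute)
  have "0 \<le> (- b - y) \<bullet> (- a - v)" if "(y, v) \<in> G" for y v
    using key[OF that] by (meson order_trans zero_le_power2)
  then have "(- b, - a) \<in> G" using maximal by auto
  with key[OF this] have "a + b = 0" by simp
  with \<open>(- b, - a) \<in> G\<close> show thesis
    using that[of a] by (metis add_eq_0_iff minus_minus)
qed

section \<open>Alpha-monotone operators and their resolvents\<close>

lemma alpha_monotoneD:
  assumes "alpha_monotone \<alpha> A" and "u \<in> A x" and "v \<in> A y"
  shows "\<alpha> * (norm (x - y))\<^sup>2 \<le> (x - y) \<bullet> (u - v)"
  using assms by (auto simp: alpha_monotone_def op_graph_def)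

text \<open>Otherwise \<open>(x, u)\<close> could be adjoined to the graph without losing
  \<alpha>-monotonicity, against maximality.\<close>

lemma maximally_alpha_monotone_memI:
  assumes max: "maximally_alpha_monotone \<alpha> A"
    and rel: "\<And>y v. v \<in> A y \<Longrightarrow> \<alpha> * (norm (x - y))\<^sup>2 \<le> (x - y) \<bullet> (u - v)"
  shows "u \<in> A x"
proof (rule ccontr)
  assume "u \<notin> A x"
  define A' where "A' = A(x := insert u (A x))"
  have "op_graph A' = insert (x, u) (op_graph A)"
    by (auto simp: A'_def op_graph_def split: if_splits)
  moreover have "alpha_monotone \<alpha> A'"
    unfolding alpha_monotone_def \<open>op_graph A' = insert (x, u) (op_graph A)\<close>
  proof clarsimp
    have "alpha_monotone \<alpha> A" using max by (simp add: maximally_alpha_monotone_def)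
    have sym: "(y - x) \<bullet> (v - u) = (x - y) \<bullet> (u - v)" for y v
      by (simp add: inner_simps)
    show "(\<forall>(y, v)\<in>op_graph A. \<alpha> * (norm (x - y))\<^sup>2 \<le> (x - y) \<bullet> (u - v)) \<and>
      (\<forall>(y, w)\<in>op_graph A. \<alpha> * (norm (y - x))\<^sup>2 \<le> (y - x) \<bullet> (w - u) \<and>
        (\<forall>(y', v)\<in>op_graph A. \<alpha> * (norm (y - y'))\<^sup>2 \<le> (y - y') \<bullet> (w - v)))"
      using rel \<open>alpha_monotone \<alpha> A\<close>
      by (auto simp: op_graph_def sym norm_minus_commute intro: alpha_monotoneD)
  qed
  moreover have "(x, u) \<notin> op_graph A" using \<open>u \<notin> A x\<close> by (simp add: op_graph_def)
  ultimately show False using max unfolding maximally_alpha_monotone_def by blast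
qed

lemma mem_resolvent_iff: "x \<in> resolvent \<gamma> A z \<longleftrightarrow> (\<exists>u\<in>A x. x + \<gamma> *\<^sub>R u = z)"
  by (auto simp: resolvent_def op_inverse_def op_plus_def single_valued_op_def op_scale_def)

text \<open>Minty's theorem after an affine change of the values. Here \<alpha> may be negative;
  positivity of \<open>1 + \<gamma> * \<alpha>\<close> makes the change keep the sign of the
  monotonicity inequality.\<close>

lemma resolvent_nonempty:
  fixes A :: "'a::{real_inner, complete_space} \<Rightarrow> 'a set"
  assumes max: "maximally_alpha_monotone \<alpha> A" and "\<gamma> > 0" and "1 + \<gamma> * \<alpha> > 0"
  shows "resolvent \<gamma> A z \<noteq> {}"
proof -
  define c where "c = 1 + \<gamma> * \<alpha>"
  have "c > 0" using assms by (simp add: c_def)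
  define f where "f x w = \<alpha> *\<^sub>R x + (1 / \<gamma>) *\<^sub>R (c *\<^sub>R w + z)" for x w
  \<comment> \<open>The substitution \<open>f\<close> turns the \<open>\<alpha>\<close>-monotone operator into a monotone one and the inclusion
    \<open>z \<in> x + \<gamma> A x\<close> into \<open>-x \<in> G x\<close>.\<close>
  define G where "G = {(x, w). f x w \<in> A x}"
  have f_inner: "(x - y) \<bullet> (f x w - f y w') = \<alpha> * (norm (x - y))\<^sup>2 + (c / \<gamma>) * ((x - y) \<bullet> (w - w'))"
    for x y w w'
    unfolding f_def by (simp add: power2_norm_eq_inner inner_simps algebra_simps)
  have "(x, w) \<in> G \<longleftrightarrow> (\<forall>(y, w')\<in>G. 0 \<le> (x - y) \<bullet> (w - w'))" for x w
  proof
    assume "(x, w) \<in> G"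
    then have "\<alpha> * (norm (x - y))\<^sup>2 \<le> (x - y) \<bullet> (f x w - f y w')" if "(y, w') \<in> G" for y w'
      using that max by (auto simp: G_def maximally_alpha_monotone_def intro: alpha_monotoneD)
    then show "\<forall>(y, w')\<in>G. 0 \<le> (x - y) \<bullet> (w - w')"
      using \<open>c > 0\<close> \<open>\<gamma> > 0\<close> by (auto simp: f_inner zero_le_mult_iff zero_le_divide_iff)
  next
    assume rel: "\<forall>(y, w')\<in>G. 0 \<le> (x - y) \<bullet> (w - w')"
    have "f x w \<in> A x"
    proof (rule maximally_alpha_monotone_memI[OF max])
      fix y v assume "v \<in> A y"
      \<comment> \<open>This solves \<open>f y w' = v\<close>, so every point of the graph of
        \<open>A\<close> comes from a point of \<open>G\<close>.\<close>
      define w' where "w' = (1 / c) *\<^sub>R (\<gamma> *\<^sub>R (v - \<alpha> *\<^sub>R y) - z)"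
      have "f y w' = v" using \<open>c > 0\<close> \<open>\<gamma> > 0\<close> by (simp add: f_def w'_def)
      then have "0 \<le> (x - y) \<bullet> (w - w')" using rel \<open>v \<in> A y\<close> by (auto simp: G_def)
      then have "0 \<le> (c / \<gamma>) * ((x - y) \<bullet> (w - w'))"
        using \<open>c > 0\<close> \<open>\<gamma> > 0\<close> by (intro mult_nonneg_nonneg) auto
      then show "\<alpha> * (norm (x - y))\<^sup>2 \<le> (x - y) \<bullet> (f x w - v)"
        using f_inner[of x y w w'] \<open>f y w' = v\<close> by simp
    qed
    then show "(x, w) \<in> G" by (simp add: G_def)
  qed
  then obtain x where "(x, - x) \<in> G" by (rule minty)
  then have "f x (- x) \<in> A x" by (simp add: G_def)
  moreover have "x + \<gamma> *\<^sub>R f x (- x) = z"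
    using \<open>\<gamma> > 0\<close> by (simp add: f_def c_def scaleR_add_right scaleR_add_left)
  ultimately show ?thesis using mem_resolvent_iff by blast
qed

text \<open>Pair \<open>z - z'\<close> with \<open>x - y\<close>, apply Cauchy-Schwarz and cancel
  \<open>norm (x - y)\<close>. If \<open>1 + \<gamma> * \<alpha>\<close> is positive, taking
  \<open>z = z'\<close> shows that the resolvent has at most one value.\<close>

lemma resolvent_lipschitz:
  assumes "alpha_monotone \<alpha> A" and "\<gamma> > 0"
    and "x \<in> resolvent \<gamma> A z" and "y \<in> resolvent \<gamma> A z'"
  shows "(1 + \<gamma> * \<alpha>) * norm (x - y) \<le> norm (z - z')"
proof (cases "x = y")
  case False
  obtain u v where u: "u \<in> A x" "x + \<gamma> *\<^sub>R u = z" and v: "v \<in> A y" "y + \<gamma> *\<^sub>R v = z'"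
    using assms by (auto simp: mem_resolvent_iff)
  have "(1 + \<gamma> * \<alpha>) * (norm (x - y))\<^sup>2 = (norm (x - y))\<^sup>2 + \<gamma> * (\<alpha> * (norm (x - y))\<^sup>2)"
    by (simp add: algebra_simps)
  also have "\<dots> \<le> (norm (x - y))\<^sup>2 + \<gamma> * ((x - y) \<bullet> (u - v))"
    using alpha_monotoneD[OF assms(1) u(1) v(1)] \<open>\<gamma> > 0\<close> by simp
  also have "\<dots> = (x - y) \<bullet> (z - z')"
    unfolding u(2)[symmetric] v(2)[symmetric]
    by (simp add: power2_norm_eq_inner inner_simps algebra_simps)
  also have "\<dots> \<le> norm (x - y) * norm (z - z')" by (rule norm_cauchy_schwarz)
  finally show ?thesis using False by (simp add: power2_eq_square)
qed simp

section \<open>Lipschitz constants of the forward step\<close>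

text \<open>The map is \<open>Id - \<gamma> (\<theta> B + \<sigma> Id)\<close>, where the bracket is
  \<mu>-monotone and \<open>L\<close>-Lipschitz. Expanding the squared norm bounds the squared
  Lipschitz constant by \<open>s\<close>, and the bound on \<gamma> says exactly that
  \<open>s < 1\<close>.\<close>

lemma forward_step_lipschitz_monotone:
  fixes B :: "'a::real_inner \<Rightarrow> 'a"
  assumes mono: "alpha_monotone \<alpha> (single_valued_op B)" and lip: "\<kappa>-lipschitz_on UNIV B"
    and pos: "\<gamma> > 0" "\<theta> > 0" "\<sigma> > 0" "\<kappa> > 0"
    and small: "\<gamma> < 2 * (\<theta> * \<alpha> + \<sigma>) / (\<theta> * \<kappa> + \<sigma>)\<^sup>2"
  obtains r where "0 \<le> r" "r < 1"
    "\<And>x y. norm (((1 - \<gamma> * \<sigma>) *\<^sub>R x - (\<gamma> * \<theta>) *\<^sub>R B x) - ((1 - \<gamma> * \<sigma>) *\<^sub>R y - (\<gamma> * \<theta>) *\<^sub>R B y))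
      \<le> r * norm (x - y)"
proof -
  define \<mu> where "\<mu> = \<theta> * \<alpha> + \<sigma>"
  define L where "L = \<theta> * \<kappa> + \<sigma>"
  define s where "s = 1 - 2 * \<gamma> * \<mu> + \<gamma>\<^sup>2 * L\<^sup>2"
  have "L > 0" using pos by (simp add: L_def add_pos_pos)
  have "\<gamma> * L\<^sup>2 < 2 * \<mu>"
    using small \<open>L > 0\<close> by (simp add: \<mu>_def L_def pos_less_divide_eq)
  then have "\<gamma> * (\<gamma> * L\<^sup>2) < \<gamma> * (2 * \<mu>)" using pos by simp
  then have "s < 1" by (simp add: s_def power2_eq_square)
  define F where "F x = (1 - \<gamma> * \<sigma>) *\<^sub>R x - (\<gamma> * \<theta>) *\<^sub>R B x" for x
  have step: "(norm (F x - F y))\<^sup>2 \<le> s * (norm (x - y))\<^sup>2" for x y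
  proof -
    define d e where "d = x - y" and "e = \<theta> *\<^sub>R (B x - B y) + \<sigma> *\<^sub>R d"
    have "\<alpha> * (norm d)\<^sup>2 \<le> d \<bullet> (B x - B y)"
      using alpha_monotoneD[OF mono, of "B x" x "B y" y] by (simp add: single_valued_op_def d_def)
    then have "\<theta> * (\<alpha> * (norm d)\<^sup>2) \<le> \<theta> * (d \<bullet> (B x - B y))" using pos by simp
    then have "\<mu> * (norm d)\<^sup>2 \<le> d \<bullet> e"
      by (simp add: e_def \<mu>_def inner_add_right power2_norm_eq_inner algebra_simps)
    then have de: "2 * \<gamma> * (\<mu> * (norm d)\<^sup>2) \<le> 2 * \<gamma> * (d \<bullet> e)" using pos by simp
    have "norm (B x - B y) \<le> \<kappa> * norm d"
      using lipschitz_onD[OF lip, of x y] by (simp add: dist_norm d_def)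
    then have "\<theta> * norm (B x - B y) \<le> \<theta> * (\<kappa> * norm d)" using pos by simp
    moreover have "norm e \<le> \<theta> * norm (B x - B y) + \<sigma> * norm d"
      using norm_triangle_ineq[of "\<theta> *\<^sub>R (B x - B y)" "\<sigma> *\<^sub>R d"] pos by (simp add: e_def)
    ultimately have "norm e \<le> L * norm d" by (simp add: L_def algebra_simps)
    then have "(norm e)\<^sup>2 \<le> L\<^sup>2 * (norm d)\<^sup>2"
      by (metis norm_ge_zero power_mono power_mult_distrib)
    then have ee: "\<gamma>\<^sup>2 * (norm e)\<^sup>2 \<le> \<gamma>\<^sup>2 * (L\<^sup>2 * (norm d)\<^sup>2)" by (simp add: mult_left_mono)
    have "F x - F y = d - \<gamma> *\<^sub>R e"
      by (simp add: F_def d_def e_def algebra_simps)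
    moreover have "(norm (d - \<gamma> *\<^sub>R e))\<^sup>2 = (norm d)\<^sup>2 - 2 * \<gamma> * (d \<bullet> e) + \<gamma>\<^sup>2 * (norm e)\<^sup>2"
      unfolding power2_norm_eq_inner
      by (simp add: inner_simps inner_commute power2_eq_square algebra_simps)
    ultimately have "(norm (F x - F y))\<^sup>2
        = (norm d)\<^sup>2 - 2 * \<gamma> * (d \<bullet> e) + \<gamma>\<^sup>2 * (norm e)\<^sup>2"
      by simp
    with de ee show ?thesis by (simp add: s_def d_def algebra_simps)
  qed
  show thesis
  proof (rule that)
    \<comment> \<open>On the trivial space \<open>s\<close> may be negative.\<close>
    show "0 \<le> sqrt (max 0 s)" "sqrt (max 0 s) < 1" using \<open>s < 1\<close> by auto
    fix x y :: 'a
    have "s * (norm (x - y))\<^sup>2 \<le> max 0 s * (norm (x - y))\<^sup>2" by (intro mult_right_mono) auto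
    with step[of x y] have "(norm (F x - F y))\<^sup>2 \<le> (sqrt (max 0 s) * norm (x - y))\<^sup>2"
      by (simp add: power_mult_distrib)
    then show "norm (((1 - \<gamma> * \<sigma>) *\<^sub>R x - (\<gamma> * \<theta>) *\<^sub>R B x)
        - ((1 - \<gamma> * \<sigma>) *\<^sub>R y - (\<gamma> * \<theta>) *\<^sub>R B y)) \<le> sqrt (max 0 s) * norm (x - y)"
      unfolding F_def by (rule power2_le_imp_le) simp
  qed
qed

text \<open>The forward step is a combination of \<open>Id\<close> and the nonexpansive map
  \<open>2 \<beta> B - Id\<close> with coefficients \<open>1 - \<gamma> \<sigma> - t\<close> and
  \<open>- t\<close>; the sum of their absolute values is a Lipschitz constant.\<close>

lemma forward_step_lipschitz_cocoercive:
  fixes B :: "'a::real_inner \<Rightarrow> 'a"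
  assumes coco: "cocoercive \<beta> B"
    and pos: "\<gamma> > 0" "\<theta> > 0" "\<sigma> > 0" "\<beta> > 0"
    and small: "\<gamma> < 2 * \<beta> / (\<theta> + \<beta> * \<sigma>)"
  obtains r where "0 \<le> r" "r < 1"
    "\<And>x y. norm (((1 - \<gamma> * \<sigma>) *\<^sub>R x - (\<gamma> * \<theta>) *\<^sub>R B x) - ((1 - \<gamma> * \<sigma>) *\<^sub>R y - (\<gamma> * \<theta>) *\<^sub>R B y))
      \<le> r * norm (x - y)"
proof -
  define t where "t = \<gamma> * \<theta> / (2 * \<beta>)"
  have t: "t > 0" "\<gamma> * \<theta> = 2 * \<beta> * t" using pos by (auto simp: t_def)
  have "\<theta> + \<beta> * \<sigma> > 0" using pos by (simp add: add_pos_pos)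
  then have "\<gamma> * \<theta> + \<beta> * (\<gamma> * \<sigma>) < 2 * \<beta>"
    using small by (simp add: field_simps)
  then have "\<beta> * (2 * t + \<gamma> * \<sigma>) < \<beta> * 2" using t by (simp add: algebra_simps)
  then have lt: "2 * t + \<gamma> * \<sigma> < 2" using pos by simp
  show thesis
  proof (rule that)
    show "0 \<le> \<bar>1 - \<gamma> * \<sigma> - t\<bar> + t" using t by simp
    have "\<gamma> * \<sigma> > 0" using pos by simp
    \<comment> \<open>Depending on the sign inside the absolute value, the sum is
      \<open>1 - \<gamma> * \<sigma>\<close> or \<open>2 * t + \<gamma> * \<sigma> - 1\<close>; the
      second is where the bound on \<gamma> enters.\<close>
    then show "\<bar>1 - \<gamma> * \<sigma> - t\<bar> + t < 1" using lt by linarith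
    fix x y :: 'a
    define d e where "d = x - y" and "e = B x - B y"
    \<comment> \<open>Cocoercivity says that the reflection \<open>2 \<beta> B - Id\<close> is nonexpansive.\<close>
    have "\<beta> * (norm e)\<^sup>2 \<le> d \<bullet> e" using coco by (simp add: cocoercive_def d_def e_def)
    then have "4 * \<beta> * (\<beta> * (norm e)\<^sup>2) \<le> 4 * \<beta> * (d \<bullet> e)" using pos by simp
    moreover have "(norm ((2 * \<beta>) *\<^sub>R e - d))\<^sup>2
        = 4 * \<beta> * (\<beta> * (norm e)\<^sup>2) - 4 * \<beta> * (d \<bullet> e) + (norm d)\<^sup>2"
      by (simp add: power2_norm_eq_inner inner_simps inner_commute algebra_simps)
    ultimately have "(norm ((2 * \<beta>) *\<^sub>R e - d))\<^sup>2 \<le> (norm d)\<^sup>2" by simp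
    then have refl: "norm ((2 * \<beta>) *\<^sub>R e - d) \<le> norm d" by (rule power2_le_imp_le) simp
    have "((1 - \<gamma> * \<sigma>) *\<^sub>R x - (\<gamma> * \<theta>) *\<^sub>R B x) - ((1 - \<gamma> * \<sigma>) *\<^sub>R y - (\<gamma> * \<theta>) *\<^sub>R B y)
        = (1 - \<gamma> * \<sigma> - t) *\<^sub>R d - t *\<^sub>R ((2 * \<beta>) *\<^sub>R e - d)"
      unfolding t(2) by (simp add: d_def e_def algebra_simps)
    also have "norm \<dots> \<le> \<bar>1 - \<gamma> * \<sigma> - t\<bar> * norm d + t * norm ((2 * \<beta>) *\<^sub>R e - d)"
      using norm_triangle_ineq4[of "(1 - \<gamma> * \<sigma> - t) *\<^sub>R d" "t *\<^sub>R ((2 * \<beta>) *\<^sub>R e - d)"] t by simp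
    also have "\<dots> \<le> \<bar>1 - \<gamma> * \<sigma> - t\<bar> * norm d + t * norm d"
      using refl t by simp
    finally show "norm (((1 - \<gamma> * \<sigma>) *\<^sub>R x - (\<gamma> * \<theta>) *\<^sub>R B x)
        - ((1 - \<gamma> * \<sigma>) *\<^sub>R y - (\<gamma> * \<theta>) *\<^sub>R B y)) \<le> (\<bar>1 - \<gamma> * \<sigma> - t\<bar> + t) * norm (x - y)"
      by (simp add: d_def algebra_simps)
  qed
qed

section \<open>Generated sequences and linear convergence\<close>

lemma generated_sequence_singleton_iff:
  "generated_sequence (\<lambda>y. {f y}) x0 x \<longleftrightarrow> x = (\<lambda>n. (f ^^ n) x0)"
proof
  assume gen: "generated_sequence (\<lambda>y. {f y}) x0 x"
  have "x n = (f ^^ n) x0" for n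
  proof (induction n)
    case 0
    show ?case using gen by (simp add: generated_sequence_def)
  next
    case (Suc n)
    have "f (x n) = x (Suc n)" using gen by (simp add: generated_sequence_def)
    with Suc show ?case by simp
  qed
  then show "x = (\<lambda>n. (f ^^ n) x0)" by blast
qed (simp add: generated_sequence_def)

text \<open>All quotients are at most \<open>r\<close>: if \<open>x k = p\<close>, the step bound
  forces \<open>x (Suc k) = p\<close>, and the extended quotient 0 / 0 is 0.\<close>

lemma converges_linearlyI:
  assumes "0 \<le> r" and "r < 1" and step: "\<And>k. norm (x (Suc k) - p) \<le> r * norm (x k - p)"
  shows "converges_linearly x p"
proof -
  have "ereal (norm (x (Suc k) - p)) / ereal (norm (x k - p)) \<le> ereal r" for k
    using step[of k] \<open>0 \<le> r\<close> by (cases "x k = p") (auto simp: field_simps)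
  then have "limsup (\<lambda>k. ereal (norm (x (Suc k) - p)) / ereal (norm (x k - p))) \<le> ereal r"
    by (intro Limsup_bounded always_eventually) auto
  also have "ereal r < 1" using \<open>r < 1\<close> by simp
  finally show ?thesis by (simp add: converges_linearly_def)
qed

section \<open>Convergence of the forward-backward iteration\<close>

text \<open>Existence of the sequence is a separate conjunct, as the claim about all generated
  sequences would be vacuous if there were none.\<close>

theorem theorem2:
  fixes A :: "'a::{real_inner, complete_space} \<Rightarrow> 'a set"
    and B :: "'a \<Rightarrow> 'a"
    and q x0 :: 'a
    and \<alpha>\<^sub>A \<alpha>\<^sub>B \<gamma> \<theta> \<sigma>\<^sub>A \<sigma>\<^sub>B :: real
  assumes "maximally_alpha_monotone \<alpha>\<^sub>A A"
    and "\<gamma> > 0" and "\<theta> > 0" and "\<sigma>\<^sub>A > 0" and "\<sigma>\<^sub>B > 0"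
    and "(\<exists>\<kappa>>0. alpha_monotone \<alpha>\<^sub>B (single_valued_op B) \<and> \<kappa>-lipschitz_on UNIV B \<and>
            \<gamma> < 2 * (\<theta> * \<alpha>\<^sub>B + \<sigma>\<^sub>B) / (\<theta> * \<kappa> + \<sigma>\<^sub>B)\<^sup>2) \<or>
         (\<exists>\<beta>>0. cocoercive \<beta> B \<and> \<gamma> < 2 * \<beta> / (\<theta> + \<beta> * \<sigma>\<^sub>B) \<and> \<alpha>\<^sub>B = 0)"
    and "\<theta> * \<alpha>\<^sub>A + \<sigma>\<^sub>A > 0" and "\<theta> * \<alpha>\<^sub>B + \<sigma>\<^sub>B > 0"
  shows "let T = (\<lambda>y. resolvent (\<gamma> * \<theta> / (1 + \<gamma> * \<sigma>\<^sub>A)) A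
                   ((1 / (1 + \<gamma> * \<sigma>\<^sub>A)) *\<^sub>R
                     ((1 - \<gamma> * \<sigma>\<^sub>B) *\<^sub>R y - (\<gamma> * \<theta>) *\<^sub>R B y + (\<gamma> * (\<sigma>\<^sub>A + \<sigma>\<^sub>B)) *\<^sub>R q)))
         in (\<exists>!x. generated_sequence T x0 x) \<and>
            (\<exists>p. resolvent (\<theta> / (\<sigma>\<^sub>A + \<sigma>\<^sub>B)) (op_plus A (single_valued_op B)) q = {p} \<and>
                 (\<forall>x. generated_sequence T x0 x \<longrightarrow> converges_linearly x p))"
proof -
  define c where "c = 1 + \<gamma> * \<sigma>\<^sub>A"
  define \<eta> where "\<eta> = \<gamma> * \<theta> / c"
  define F where "F y = (1 - \<gamma> * \<sigma>\<^sub>B) *\<^sub>R y - (\<gamma> * \<theta>) *\<^sub>R B y" for y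
  define P where "P y = (1 / c) *\<^sub>R (F y + (\<gamma> * (\<sigma>\<^sub>A + \<sigma>\<^sub>B)) *\<^sub>R q)" for y
  define T where "T y = resolvent \<eta> A (P y)" for y
  have mono: "alpha_monotone \<alpha>\<^sub>A A"
    using assms(1) by (simp add: maximally_alpha_monotone_def)
  have "c > 1" using assms by (simp add: c_def)
  then have "\<eta> > 0" using assms by (simp add: \<eta>_def)
  \<comment> \<open>Scaling by \<open>1 / c\<close> followed by the resolvent has Lipschitz constant
    \<open>1 / (c * (1 + \<eta> * \<alpha>\<^sub>A))\<close>. The identity shows that this is at
    most 1 and that \<open>1 + \<eta> * \<alpha>\<^sub>A\<close> is positive even when
    \<open>\<alpha>\<^sub>A\<close> is negative.\<close>
  have c_eq: "c * (1 + \<eta> * \<alpha>\<^sub>A) = 1 + \<gamma> * (\<theta> * \<alpha>\<^sub>A + \<sigma>\<^sub>A)"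
    using \<open>c > 1\<close> by (simp add: \<eta>_def field_simps) (simp add: c_def algebra_simps)
  then have ge1: "1 \<le> c * (1 + \<eta> * \<alpha>\<^sub>A)" using assms by simp
  then have "0 < c * (1 + \<eta> * \<alpha>\<^sub>A)" by linarith
  then have pos: "1 + \<eta> * \<alpha>\<^sub>A > 0"
    using \<open>c > 1\<close> by (simp add: zero_less_mult_iff)
  obtain r where r: "0 \<le> r" "r < 1" and F: "\<And>x y. norm (F x - F y) \<le> r * norm (x - y)"
    using assms(6)
  proof (elim disjE exE conjE)
    fix \<kappa> assume \<kappa>: "0 < \<kappa>" "alpha_monotone \<alpha>\<^sub>B (single_valued_op B)" "\<kappa>-lipschitz_on UNIV B"
      "\<gamma> < 2 * (\<theta> * \<alpha>\<^sub>B + \<sigma>\<^sub>B) / (\<theta> * \<kappa> + \<sigma>\<^sub>B)\<^sup>2"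
    show thesis
      by (rule forward_step_lipschitz_monotone[OF \<kappa>(2,3) assms(2,3,5) \<kappa>(1,4)])
        (rule that, auto simp: F_def)
  next
    fix \<beta> assume \<beta>: "0 < \<beta>" "cocoercive \<beta> B" "\<gamma> < 2 * \<beta> / (\<theta> + \<beta> * \<sigma>\<^sub>B)"
    show thesis
      by (rule forward_step_lipschitz_cocoercive[OF \<beta>(2) assms(2,3,5) \<beta>(1,3)])
        (rule that, auto simp: F_def)
  qed
  have T_contr: "norm (u - v) \<le> r * norm (x - y)" if "u \<in> T x" "v \<in> T y" for u v x y
  proof -
    have "norm (u - v) \<le> c * (1 + \<eta> * \<alpha>\<^sub>A) * norm (u - v)"
      using mult_right_mono[OF ge1, of "norm (u - v)"] by simp
    also have "\<dots> \<le> c * norm (P x - P y)"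
      using resolvent_lipschitz[OF mono \<open>\<eta> > 0\<close> that[unfolded T_def]] \<open>c > 1\<close> by simp
    also have "P x - P y = (1 / c) *\<^sub>R (F x - F y)" by (simp add: P_def algebra_simps)
    also have "c * norm \<dots> = norm (F x - F y)" using \<open>c > 1\<close> by simp
    also have "\<dots> \<le> r * norm (x - y)" by (rule F)
    finally show ?thesis .
  qed
  define f where "f y = (SOME u. u \<in> T y)" for y
  have f_in: "f y \<in> T y" for y
    unfolding f_def using resolvent_nonempty[OF assms(1) \<open>\<eta> > 0\<close> pos] by (simp add: T_def some_in_eq)
  have T_eq: "T = (\<lambda>y. {f y})"
  proof
    fix y
    \<comment> \<open>With both arguments equal to \<open>y\<close> the contraction bound is
      0.\<close>
    have "u = f y" if "u \<in> T y" for u using T_contr[OF that f_in[of y]] by simp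
    then show "T y = {f y}" using f_in by blast
  qed
  have f_contr: "norm (f x - f y) \<le> r * norm (x - y)" for x y
    using T_contr[OF f_in f_in] .
  then have "\<exists>!p. f p = p"
    using r by (intro banach_fix_type[of r f]) (auto simp: dist_norm)
  then obtain p where p: "f p = p" and p_unique: "\<And>y. f y = y \<Longrightarrow> y = p" by auto
  have fix_iff: "y \<in> resolvent (\<theta> / (\<sigma>\<^sub>A + \<sigma>\<^sub>B)) (op_plus A (single_valued_op B)) q \<longleftrightarrow> y \<in> T y" for y
  proof -
    define s where "s = \<sigma>\<^sub>A + \<sigma>\<^sub>B"
    have "s > 0" using assms by (simp add: s_def)
    have "y + (\<theta> / s) *\<^sub>R (u + B y) = q \<longleftrightarrow> y + \<eta> *\<^sub>R u = P y" for u
    proof -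
      \<comment> \<open>The residuals of the two inclusions are proportional with a nonzero factor,
        so they vanish for the same \<open>u\<close>. Multiplying by \<open>c\<close> clears the
        denominators.\<close>
      have "y + \<eta> *\<^sub>R u - P y = (\<gamma> * s / c) *\<^sub>R (y + (\<theta> / s) *\<^sub>R (u + B y) - q)"
      proof -
        have "c *\<^sub>R (y + \<eta> *\<^sub>R u - P y) = c *\<^sub>R y + (\<gamma> * \<theta>) *\<^sub>R u - (F y + (\<gamma> * s) *\<^sub>R q)"
          using \<open>c > 1\<close> by (simp add: P_def \<eta>_def s_def scaleR_diff_right scaleR_add_right)
        also have "\<dots> = (\<gamma> * s) *\<^sub>R y + (\<gamma> * \<theta>) *\<^sub>R (u + B y) - (\<gamma> * s) *\<^sub>R q"
          by (simp add: F_def c_def s_def algebra_simps)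
        also have "\<dots> = (\<gamma> * s) *\<^sub>R (y + (\<theta> / s) *\<^sub>R (u + B y) - q)"
          using \<open>s > 0\<close> by (simp add: scaleR_diff_right scaleR_add_right)
        also have "\<dots> = c *\<^sub>R ((\<gamma> * s / c) *\<^sub>R (y + (\<theta> / s) *\<^sub>R (u + B y) - q))"
          using \<open>c > 1\<close> by simp
        finally show ?thesis using \<open>c > 1\<close> by (subst (asm) scaleR_cancel_left) auto
      qed
      moreover have "\<gamma> * s / c \<noteq> 0" using \<open>s > 0\<close> \<open>c > 1\<close> assms by simp
      ultimately have "y + \<eta> *\<^sub>R u - P y = 0 \<longleftrightarrow> y + (\<theta> / s) *\<^sub>R (u + B y) - q = 0"
        by simp
      then show ?thesis by (simp only: right_minus_eq)
    qed
    then show ?thesis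
      by (fastforce simp: T_def mem_resolvent_iff op_plus_def single_valued_op_def s_def)
  qed
  have "resolvent (\<theta> / (\<sigma>\<^sub>A + \<sigma>\<^sub>B)) (op_plus A (single_valued_op B)) q = {p}"
  proof (rule set_eqI)
    fix y
    have "y = f y \<longleftrightarrow> y = p" using p p_unique[of y] by metis
    then show "y \<in> resolvent (\<theta> / (\<sigma>\<^sub>A + \<sigma>\<^sub>B)) (op_plus A (single_valued_op B)) q \<longleftrightarrow> y \<in> {p}"
      by (simp add: fix_iff T_eq)
  qed
  moreover have "converges_linearly x p" if "generated_sequence T x0 x" for x
  proof (rule converges_linearlyI[OF r])
    fix k
    show "norm (x (Suc k) - p) \<le> r * norm (x k - p)"
      using that f_contr[of "x k" p] p by (simp add: generated_sequence_def T_eq)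
  qed
  moreover have "\<exists>!x. generated_sequence T x0 x"
    by (simp add: T_eq generated_sequence_singleton_iff)
  ultimately show ?thesis
    unfolding T_def P_def F_def \<eta>_def c_def Let_def by blast
qed

end
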